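(* For every $\epsilon>0$ there exist $0<p_\epsilon<1$ and a binary sequence $\eta\equiv\eta_\epsilon\in\Xi=\{0,1\}^{\mathbb N}$ such that the set of zeroes $\mathcal Z_\eta=\{i\ge 1:\eta_i=0\}$ is a discrete fractal with discrete Hausdorff dimension $\dim_{\mathrm H}(\mathcal Z_\eta)\ge 1-\epsilon$, and such that $$\mathbb P_p\{\xi\in\Xi:(\eta,\xi)\text{ is compatible}\}>0$$ for every $p\in[0,1]$ with $p<p_\epsilon$.
   Context: $\mathbb N=\{1,2,\dots\}$ and $\Xi=\{0,1\}^{\mathbb N}$ carries the product topology. For $p\in[0,1]$, $\mathbb P_p$ is the product probability measure on $\Xi$ with $\mathbb P_p(\xi_i=1)=p$ for all $i\ge1$. Annihilation operators on $\Xi$: for $i\in\mathbb N$, $\triangle_i^{\mathbf 0}(\xi)$ is the sequence obtained by deleting the $i$-th digit of $\xi$ (and shifting all later digits one place to the left) if $\xi_i=0$, and $\triangle_i^{\mathbf 0}(\xi)=\xi$ if $\xi_i=1$. Likewise $\triangle_i^{\mathbf 1}(\xi)$ deletes the $i$-th digit if $\xi_i=1$, and $\triangle_i^{\mathbf 1}(\xi)=\xi$ if $\xi_i=0$. A pair $(\eta,\xi)\in\Xi\times\Xi$ is compatible if there exist sequences $(\eta^{(k)})_{k\ge1}$, $(\xi^{(k)})_{k\ge1}$ in $\Xi$ such that each $\eta^{(k)}$ is obtained from $\eta$ by finitely many applications of operators $\triangle^{\mathbf 1}_{\cdot}$, each $\xi^{(k)}$ is obtained from $\xi$ by finitely many applications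 of operators $\triangle^{\mathbf 0}_{\cdot}$, and, as $k\to\infty$, both sequences converge in $\Xi$ to the same limit. Discrete dimensions (Barlow–Taylor). Let $\mathcal I$ be the set of all intervals $[x,y)$ with $x,y\in\mathbb Z$. Fix an integer $r\ge2$ and put $I_1^{(r)}=[-r,r)$ and $I_n^{(r)}=[-r^n,r^n)\setminus[-r^{n-1},r^{n-1})$ for $n\ge2$. For $\alpha>0$ and $A,F\subseteq\mathbb Z$ let $$\nu_\alpha(A,F)=\inf\Big\{\sum_i d(B_i)^\alpha:\ B_i\in\mathcal I,\ A\cap F\subseteq\bigcup_i B_i\Big\}\,d(F)^{-\alpha},\qquad m_\alpha^{(r)}(A)=\sum_{n=1}^\infty\nu_\alpha(A,I_n^{(r)}),$$ where $d([x,y))=y-x$ and, for $F=I^{(r)}_n$, $d(F)=2r^n$ is the length of the smallest interval of $\mathcal I$ containing $F$. The discrete Hausdorff dimension of $A\subseteq\mathbb Z$ is $\dim_{\mathrm H}(A)=\inf\{\alpha>0: m_\alpha^{(r)}(A)<\infty\}$. The upper entropy index of $A\subseteq\mathbb Z$ is $$\Delta(A)=\inf\Big\{\alpha>0:\ \max_{1\le d\le r^{n(1-\epsilon')}}(dr^{-n})^\alpha N(d,A\cap I_n^{(r)})\to0\ \text{as } n\to\infty\text{ for each }\epsilon'>0\Big\},$$ where $N(d,A)$ is the maximum number of disjoint intervals in $\mathcal I$ of length $2d$ with centers in $A$ ($d$ a positive integer). The index $\Delta(A)$ always coincides with the discrete packing dimension of $A$. A set $A\subseteq\mathbb Z$ is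 called a (discrete) fractal if $\dim_{\mathrm H}(A)=\Delta(A)$ (equivalently, its Hausdorff and packing dimensions coincide). *)

theory Defs
  imports "HOL-Probability.Probability"
begin

section \<open>Binary sequences and compatibility\<close>

text \<open>
  The digit \<open>\<xi>\<^sub>i\<close>, for \<open>i \<ge> 1\<close>, is \<open>\<xi> (i - 1)\<close>, and \<^const>\<open>True\<close> stands for the digit 1.
  The product topology is the one the library puts on the function type,
  \<^typ>\<open>bool\<close> being discrete.
\<close>

type_synonym binseq = "nat \<Rightarrow> bool"

definition annihilate :: "bool \<Rightarrow> nat \<Rightarrow> binseq \<Rightarrow> binseq" where
  "annihilate b i \<xi> = (if \<xi> i = b then (\<lambda>j. if j < i then \<xi> j else \<xi> (Suc j)) else \<xi>)"

definition annihilates_to :: "bool \<Rightarrow> binseq \<Rightarrow> binseq \<Rightarrow> bool" where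
  "annihilates_to b = (\<lambda>\<xi> \<xi>'. \<exists>i. \<xi>' = annihilate b i \<xi>)\<^sup>*\<^sup>*"

definition compatible :: "binseq \<Rightarrow> binseq \<Rightarrow> bool" where
  "compatible \<eta> \<xi> \<longleftrightarrow>
     (\<exists>\<eta>s \<xi>s :: nat \<Rightarrow> binseq.
        (\<forall>k. annihilates_to True \<eta> (\<eta>s k)) \<and>
        (\<forall>k. annihilates_to False \<xi> (\<xi>s k)) \<and>
        (\<exists>l. \<eta>s \<longlonglongrightarrow> l \<and> \<xi>s \<longlonglongrightarrow> l))"

definition bernoulli_product :: "real \<Rightarrow> binseq measure" where
  "bernoulli_product p = (\<Pi>\<^sub>M i\<in>UNIV. measure_pmf (bernoulli_pmf p))"

definition zeroes :: "binseq \<Rightarrow> int set" where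
  "zeroes \<eta> = {int (Suc i) |i. \<not> \<eta> i}"

section \<open>Discrete dimensions\<close>

text \<open>The empty interval \<open>[x,x)\<close> is included, so covers by sequences subsume finite covers.\<close>

definition intervals :: "int set set" where
  "intervals = {{x..<y} |x y. x \<le> y}"

text \<open>The length of the smallest interval containing \<open>F\<close>; only meaningful for bounded \<open>F\<close>.\<close>

definition width :: "int set \<Rightarrow> nat" where
  "width F = (LEAST n. \<exists>x. F \<subseteq> {x..<x + int n})"

text \<open>The value at \<open>n = 0\<close> is irrelevant.\<close>

definition shell :: "int \<Rightarrow> nat \<Rightarrow> int set" where
  "shell r n =
     (if n \<le> 1 then {- r..<r} else {- (r ^ n)..<r ^ n} - {- (r ^ (n - 1))..<r ^ (n - 1)})"

definition cover_content :: "real \<Rightarrow> int set \<Rightarrow> int set \<Rightarrow> ennreal" where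
  "cover_content \<alpha> A F =
     (INF B \<in> {B :: nat \<Rightarrow> int set. range B \<subseteq> intervals \<and> A \<inter> F \<subseteq> (\<Union>i. B i)}.
        \<Sum>i. ennreal (real (width (B i)) powr \<alpha>))
     * ennreal (real (width F) powr (- \<alpha>))"

definition discrete_hausdorff_measure :: "int \<Rightarrow> real \<Rightarrow> int set \<Rightarrow> ennreal" where
  "discrete_hausdorff_measure r \<alpha> A = (\<Sum>n. cover_content \<alpha> A (shell r (Suc n)))"

definition hausdorff_dim :: "int \<Rightarrow> int set \<Rightarrow> real" where
  "hausdorff_dim r A = Inf {\<alpha>. \<alpha> > 0 \<and> discrete_hausdorff_measure r \<alpha> A < \<infinity>}"

text \<open>An interval of length \<open>2d\<close> with centre \<open>c\<close> is \<open>[c - d, c + d)\<close>; used for finite \<open>A\<close> and \<open>d > 0\<close>.\<close>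

definition packing_number :: "nat \<Rightarrow> int set \<Rightarrow> nat" where
  "packing_number d A =
     Max {card \<S> |\<S>. \<S> \<subseteq> {{c - int d..<c + int d} |c. c \<in> A} \<and> disjoint \<S>}"

text \<open>
  The supremum is taken in \<^typ>\<open>ennreal\<close> so that it is 0 when no \<open>d\<close> is admissible,
  which happens for \<open>\<epsilon>' > 1\<close>.
\<close>

definition upper_entropy_index :: "int \<Rightarrow> int set \<Rightarrow> real" where
  "upper_entropy_index r A =
     Inf {\<alpha>. \<alpha> > 0 \<and>
       (\<forall>\<epsilon>'>0.
          (\<lambda>n. SUP d \<in> {d :: nat. 1 \<le> d \<and> real d \<le> real_of_int r powr (real n * (1 - \<epsilon>'))}.
             ennreal ((real d * real_of_int r powr (- real n)) powr \<alpha>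
                      * real (packing_number d (A \<inter> shell r n))))
          \<longlonglongrightarrow> 0)}"

definition discrete_fractal :: "int \<Rightarrow> int set \<Rightarrow> bool" where
  "discrete_fractal r A \<longleftrightarrow> hausdorff_dim r A = upper_entropy_index r A"

lemma width_interval:
  assumes "x \<le> y"
  shows "int (width {x..<y}) = y - x"
proof -
  have "width {x..<y} = nat (y - x)"
    unfolding width_def
  proof (rule Least_equality)
    show "\<exists>z. {x..<y} \<subseteq> {z..<z + int (nat (y - x))}"
      using assms by (intro exI[of _ x]) auto
  next
    fix n assume "\<exists>z. {x..<y} \<subseteq> {z..<z + int n}"
    then obtain z where "{x..<y} \<subseteq> {z..<z + int n}" by blast
    from card_mono[OF _ this] show "nat (y - x) \<le> n" by simp
  qed
  then show ?thesis using assms by simp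
qed

lemma width_shell:
  assumes "2 \<le> r" "1 \<le> n"
  shows "int (width (shell r n)) = 2 * r ^ n"
proof -
  have pos: "0 < r ^ n" using assms by simp
  have ends: "- (r ^ n) \<in> shell r n \<and> r ^ n - 1 \<in> shell r n \<and> shell r n \<subseteq> {- (r ^ n)..<r ^ n}"
  proof (cases "n = 1")
    case True
    then show ?thesis using assms by (auto simp: shell_def)
  next
    case False
    then have "r ^ (n - 1) < r ^ n"
      using assms by (intro power_strict_increasing) auto
    then have "\<not> r ^ n - 1 < r ^ (n - 1)" by linarith
    with \<open>r ^ (n - 1) < r ^ n\<close> show ?thesis using False assms pos by (auto simp: shell_def)
  qed
  have "width (shell r n) = nat (2 * r ^ n)"
    unfolding width_def
  proof (rule Least_equality)
    show "\<exists>z. shell r n \<subseteq> {z..<z + int (nat (2 * r ^ n))}"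
      using ends pos by (intro exI[of _ "- (r ^ n)"]) auto
  next
    fix m assume "\<exists>z. shell r n \<subseteq> {z..<z + int m}"
    then obtain z where "shell r n \<subseteq> {z..<z + int m}" by blast
    with ends have "z \<le> - (r ^ n)" "r ^ n - 1 < z + int m" by auto
    then show "nat (2 * r ^ n) \<le> m" by linarith
  qed
  then show ?thesis using pos by simp
qed

end

theory Submission
  imports Defs "HOL-Library.Omega_Words_Fun" "HOL-Library.Log_Nat" "HOL-Real_Asymp.Real_Asymp"
begin

text \<open>
  Cut \<open>\<nat>\<close> into consecutive blocks, the \<open>j\<close>-th of length about \<open>log\<^sub>2 j\<close>, and let the gaps between the
  zeroes of \<open>\<eta>\<close> be the sums of the lengths of two neighbouring blocks. If every block of \<open>\<xi>\<close> contains
  a zero, choose one in each block; between two consecutive chosen zeroes there are at most as many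
  digits of \<open>\<xi>\<close> as there are ones in the corresponding gap of \<open>\<eta>\<close>, so the chosen zeroes can be matched
  with the zeroes of \<open>\<eta>\<close>. For \<open>p \<le> 1/8\<close> the probabilities that the blocks of \<open>\<xi>\<close> contain no zero have
  sum at most \<open>1/2\<close>.

  The shell of radius \<open>r ^ n\<close> contains at least a constant times \<open>r ^ n / n\<close> zeroes of \<open>\<eta>\<close>. Since
  \<open>\<Sum>1/n\<close> diverges, this is just dense enough for both dimensions to be 1.
\<close>

section \<open>Compatibility as a countable condition\<close>

lemma tendsto_binseq_iff:
  fixes X :: "nat \<Rightarrow> binseq"
  shows "X \<longlonglongrightarrow> l \<longleftrightarrow> (\<forall>i. \<forall>\<^sub>F k in sequentially. X k i = l i)"
proof -
  have "X \<longlonglongrightarrow> l \<longleftrightarrow> limitin (product_topology (\<lambda>i. euclidean) UNIV) X l sequentially"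
    by (simp add: euclidean_product_topology)
  also have "\<dots> \<longleftrightarrow> (\<forall>i. \<forall>\<^sub>F k in sequentially. X k i = l i)"
    by (simp add: limitin_componentwise tendsto_discrete)
  finally show ?thesis .
qed

lemma compact_binseq: "compact (UNIV :: binseq set)"
proof -
  have "compactin (product_topology (\<lambda>i::nat. euclidean :: bool topology) UNIV) (Pi\<^sub>E UNIV (\<lambda>_. UNIV))"
    by (subst compactin_PiE) (auto simp: finite_imp_compact)
  then show ?thesis
    by (simp add: euclidean_product_topology)
qed

lemma open_cylinder:
  fixes l :: binseq
  shows "open {\<zeta> :: binseq. \<forall>i<n. \<zeta> i = l i}"
proof -
  have "open {\<zeta>. \<forall>i\<in>{..<n}. \<zeta> i \<in> {l i}}"
    by (rule product_topology_basis'[where x = "\<lambda>i. i"]) (auto intro: discrete_topology_class.open_discrete)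
  then show ?thesis by (simp add: Ball_def)
qed

text \<open>Compactness takes the place of extracting a convergent subsequence: the image filter of
  \<open>X\<close> clusters at some \<open>l\<close>, and the cylinders around \<open>l\<close> are
  open, so each of them is entered at arbitrarily late times.\<close>

lemma cluster_point_binseq:
  fixes X :: "nat \<Rightarrow> binseq"
  obtains l where "\<And>n. \<exists>k\<ge>n. \<forall>i<n. X k i = l i"
proof -
  have "filtermap X sequentially \<noteq> bot"
    by (simp add: filtermap_bot_iff)
  then obtain l where l: "inf (nhds l) (filtermap X sequentially) \<noteq> bot"
    using compact_binseq unfolding compact_filter by auto
  have "\<exists>k\<ge>n. \<forall>i<n. X k i = l i" for n
  proof (rule ccontr)
    assume "\<not> ?thesis"
    then have "\<forall>\<^sub>F \<zeta> in filtermap X sequentially. \<not> (\<forall>i<n. \<zeta> i = l i)"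
      by (auto simp: eventually_filtermap eventually_sequentially intro!: exI[of _ n])
    moreover have "\<forall>\<^sub>F \<zeta> in nhds l. \<forall>i<n. \<zeta> i = l i"
      using open_cylinder[of n l] by (intro eventually_nhds[THEN iffD2]) auto
    ultimately have "\<forall>\<^sub>F \<zeta> in inf (nhds l) (filtermap X sequentially). False"
      unfolding eventually_inf by blast
    with l show False
      by (simp add: eventually_False)
  qed
  with that show thesis by blast
qed

text \<open>Both limits are replaced by agreement on longer and longer prefixes. To get the limits
  back, take a cluster point of the reduced versions of \<xi>; those of \<eta> converge to it along
  the same indices, because they share these prefixes.\<close>

lemma compatible_iff_prefixes:
  "compatible \<eta> \<xi> \<longleftrightarrow>
     (\<forall>n. \<exists>\<eta>' \<xi>'. annihilates_to True \<eta> \<eta>' \<and> annihilates_to False \<xi> \<xi>' \<and> (\<forall>i<n. \<eta>' i = \<xi>' i))"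
  (is "_ \<longleftrightarrow> (\<forall>n. \<exists>\<eta>' \<xi>'. ?P n \<eta>' \<xi>')")
proof
  assume "compatible \<eta> \<xi>"
  then obtain \<eta>s \<xi>s l where *: "\<And>k. annihilates_to True \<eta> (\<eta>s k)" "\<And>k. annihilates_to False \<xi> (\<xi>s k)"
    "\<eta>s \<longlonglongrightarrow> l" "\<xi>s \<longlonglongrightarrow> l"
    unfolding compatible_def by blast
  show "\<forall>n. \<exists>\<eta>' \<xi>'. ?P n \<eta>' \<xi>'"
  proof
    fix n
    have "\<forall>\<^sub>F k in sequentially. \<forall>i\<in>{..<n}. \<eta>s k i = l i \<and> \<xi>s k i = l i"
      using *(3,4) by (intro eventually_ball_finite ballI eventually_conj) (auto simp: tendsto_binseq_iff)
    then obtain k where "\<forall>i<n. \<eta>s k i = l i \<and> \<xi>s k i = l i"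
      by (auto simp: eventually_sequentially)
    with * show "\<exists>\<eta>' \<xi>'. ?P n \<eta>' \<xi>'" by metis
  qed
next
  assume "\<forall>n. \<exists>\<eta>' \<xi>'. ?P n \<eta>' \<xi>'"
  then obtain Y X where YX: "\<And>n. ?P n (Y n) (X n)"
    by metis
  obtain l where "\<And>n. \<exists>k\<ge>n. \<forall>i<n. X k i = l i"
    using cluster_point_binseq by blast
  \<comment> \<open>With \<open>h n\<close> at least \<open>n\<close>, the sequences
    \<open>Y (h n)\<close> and \<open>X (h n)\<close> agree with each other, and hence with
    \<open>l\<close>, on the first \<open>n\<close> digits.\<close>
  then obtain h where h: "\<And>n. h n \<ge> n" "\<And>n i. i < n \<Longrightarrow> X (h n) i = l i"
    by metis
  have "Y (h n) i = l i" if "i < n" for n i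
    using h(1)[of n] h(2)[OF that] YX[of "h n"] that by auto
  then have "(\<lambda>n. Y (h n)) \<longlonglongrightarrow> l" "(\<lambda>n. X (h n)) \<longlonglongrightarrow> l"
    using h(2) unfolding tendsto_binseq_iff eventually_sequentially by (metis Suc_le_eq)+
  moreover have "annihilates_to True \<eta> (Y (h n))" "annihilates_to False \<xi> (X (h n))" for n
    using YX by auto
  ultimately show "compatible \<eta> \<xi>"
    unfolding compatible_def by (intro exI[of _ "\<lambda>n. Y (h n)"] exI[of _ "\<lambda>n. X (h n)"]) auto
qed

text \<open>A finite run of deletions is encoded by the list of its indices. Lists of numbers form a
  countable type, so compatibility becomes a condition with countable quantifiers only.\<close>

lemma annihilates_to_iff_fold:
  "annihilates_to b \<xi> \<xi>' \<longleftrightarrow> (\<exists>is. \<xi>' = fold (annihilate b) is \<xi>)"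
proof
  show "annihilates_to b \<xi> \<xi>' \<Longrightarrow> \<exists>is. \<xi>' = fold (annihilate b) is \<xi>"
    unfolding annihilates_to_def
  proof (induction rule: rtranclp_induct)
    case base
    show ?case by (rule exI[of _ "[]"]) simp
  next
    case (step \<zeta> \<zeta>')
    then obtain "is" i where "\<zeta> = fold (annihilate b) is \<xi>" "\<zeta>' = annihilate b i \<zeta>" by blast
    then show ?case by (intro exI[of _ "is @ [i]"]) simp
  qed
  have "annihilates_to b \<xi> (fold (annihilate b) is \<xi>)" for "is"
    by (induction "is" arbitrary: \<xi>)
       (auto simp: annihilates_to_def intro: converse_rtranclp_into_rtranclp)
  then show "\<exists>is. \<xi>' = fold (annihilate b) is \<xi> \<Longrightarrow> annihilates_to b \<xi> \<xi>'"
    by auto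
qed

lemma compatible_iff_fold:
  "compatible \<eta> \<xi> \<longleftrightarrow>
     (\<forall>n. \<exists>is js. \<forall>i<n. fold (annihilate True) is \<eta> i = fold (annihilate False) js \<xi> i)"
  unfolding compatible_iff_prefixes annihilates_to_iff_fold by (rule iff_allI) blast

section \<open>Measurability of compatibility and probabilities of cylinders\<close>

lemma space_bernoulli_product [simp]: "space (bernoulli_product p) = UNIV"
  by (simp add: bernoulli_product_def space_PiM)

lemma sets_bernoulli_product:
  "sets (bernoulli_product p) = sets (Pi\<^sub>M UNIV (\<lambda>_::nat. count_space (UNIV :: bool set)))"
  unfolding bernoulli_product_def by (intro sets_PiM_cong) auto

text \<open>Digit \<open>j\<close> of the image is determined by the digits \<open>i\<close>,
  \<open>j\<close> and \<open>Suc j\<close>, so measurability can be checked coordinate by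
  coordinate.\<close>

lemma measurable_annihilate [measurable]:
  "annihilate b i \<in> bernoulli_product p \<rightarrow>\<^sub>M bernoulli_product p"
proof -
  have [measurable]: "(\<lambda>\<xi>. \<xi> j) \<in> Pi\<^sub>M UNIV (\<lambda>_::nat. count_space (UNIV :: bool set)) \<rightarrow>\<^sub>M count_space UNIV" for j
    by (rule measurable_component_singleton) simp
  have "annihilate b i = (\<lambda>\<xi> j. if \<xi> i = b then if j < i then \<xi> j else \<xi> (Suc j) else \<xi> j)"
    by (auto simp: annihilate_def fun_eq_iff)
  moreover have "\<dots> \<in> Pi\<^sub>M UNIV (\<lambda>_::nat. count_space (UNIV :: bool set)) \<rightarrow>\<^sub>M Pi\<^sub>M UNIV (\<lambda>_::nat. count_space (UNIV :: bool set))"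
    by (rule measurable_PiM_single') (auto simp: space_PiM)
  ultimately show ?thesis
    using measurable_cong_sets[OF sets_bernoulli_product sets_bernoulli_product] by auto
qed

text \<open>The event is built from conditions on single digits by countable unions and
  intersections. Measurability is what allows its probability to be bounded below by that of a
  subset.\<close>

lemma measurable_compatible: "{\<xi>. compatible \<eta> \<xi>} \<in> sets (bernoulli_product p)"
proof -
  have comp [measurable]: "(\<lambda>\<xi>. \<xi> j) \<in> bernoulli_product p \<rightarrow>\<^sub>M count_space UNIV" for j
    unfolding measurable_cong_sets[OF sets_bernoulli_product refl]
    by (rule measurable_component_singleton) simp
  have fold [measurable]: "fold (annihilate b) is \<in> bernoulli_product p \<rightarrow>\<^sub>M bernoulli_product p" for b "is"
    by (induction "is") (auto intro: measurable_comp)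
  have dig [measurable]: "(\<lambda>\<xi>. fold (annihilate b) is \<xi> j) \<in> bernoulli_product p \<rightarrow>\<^sub>M count_space UNIV" for b "is" j
    using measurable_compose[OF fold comp] .
  have "{\<xi>. compatible \<eta> \<xi>} = {\<xi> \<in> space (bernoulli_product p). \<forall>n. \<exists>is js. \<forall>i<n.
      fold (annihilate True) is \<eta> i = fold (annihilate False) js \<xi> i}"
    by (simp add: compatible_iff_fold)
  also have "\<dots> \<in> sets (bernoulli_product p)"
    by measurable
  finally show ?thesis .
qed

lemma prob_all_ones:
  assumes "finite I" "p \<in> {0..1}"
  shows "measure (bernoulli_product p) {\<xi>. \<forall>i\<in>I. \<xi> i} = p ^ card I"
    and "{\<xi>. \<forall>i\<in>I. \<xi> i} \<in> sets (bernoulli_product p)"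
proof -
  interpret product_prob_space "\<lambda>_::nat. measure_pmf (bernoulli_pmf p)" UNIV
    by unfold_locales
  have eq: "{\<xi>. \<forall>i\<in>I. \<xi> i} = prod_emb UNIV (\<lambda>_::nat. measure_pmf (bernoulli_pmf p)) I (Pi\<^sub>E I (\<lambda>_. {True}))"
    unfolding prod_emb_def vimage_def restrict_PiE_iff by auto
  show "measure (bernoulli_product p) {\<xi>. \<forall>i\<in>I. \<xi> i} = p ^ card I"
    unfolding bernoulli_product_def eq using assms
    by (subst measure_PiM_emb) (auto simp: measure_pmf_single)
  show "{\<xi>. \<forall>i\<in>I. \<xi> i} \<in> sets (bernoulli_product p)"
    unfolding bernoulli_product_def eq using assms
    by (intro measurable_prod_emb sets_PiM_I_finite) auto
qed

lemma prob_space_bernoulli_product: "prob_space (bernoulli_product p)"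
  unfolding bernoulli_product_def by (intro prob_space_PiM measure_pmf.prob_space_axioms)

section \<open>Matching zeroes\<close>

lemma annihilates_to_refl [simp]: "annihilates_to b \<xi> \<xi>"
  by (simp add: annihilates_to_def)

lemma annihilates_to_trans [trans]:
  "annihilates_to b \<xi> \<xi>' \<Longrightarrow> annihilates_to b \<xi>' \<xi>'' \<Longrightarrow> annihilates_to b \<xi> \<xi>''"
  by (simp add: annihilates_to_def)

lemma annihilates_to_conc:
  assumes "annihilates_to b \<xi> \<xi>'"
  shows "annihilates_to b (u \<frown> \<xi>) (u \<frown> \<xi>')"
  using assms unfolding annihilates_to_def
proof (induction rule: rtranclp_induct)
  case (step \<zeta> \<zeta>')
  then obtain i where "\<zeta>' = annihilate b i \<zeta>" by blast
  then have "u \<frown> \<zeta>' = annihilate b (length u + i) (u \<frown> \<zeta>)"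
    by (auto simp: annihilate_def fun_eq_iff conc_def Suc_diff_le)
  with step.IH show ?case
    by (auto intro: rtranclp.rtrancl_into_rtrancl)
qed simp

lemma annihilates_to_drop_hd: "annihilates_to b ([b] \<frown> \<xi>) \<xi>"
proof -
  have "\<xi> = annihilate b 0 ([b] \<frown> \<xi>)"
    by (auto simp: annihilate_def conc_def)
  then show ?thesis
    unfolding annihilates_to_def by (intro r_into_rtranclp exI)
qed

text \<open>Deletion proceeds from the right: the tail is cleaned first, with the head carried along
  by \<open>annihilates_to_conc\<close>, and then the head is removed if it equals
  \<open>b\<close>.\<close>

lemma annihilates_to_filter:
  "annihilates_to b (u \<frown> \<xi>) (filter (\<lambda>c. c \<noteq> b) u \<frown> \<xi>)"
proof (induction u)
  case (Cons a u)
  have "annihilates_to b ((a # u) \<frown> \<xi>) ([a] \<frown> (filter (\<lambda>c. c \<noteq> b) u \<frown> \<xi>))"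
    using annihilates_to_conc[OF Cons.IH, of "[a]"] by simp
  with annihilates_to_drop_hd[of b "filter (\<lambda>c. c \<noteq> b) u \<frown> \<xi>"] show ?case
    by (cases "a = b") (auto intro: annihilates_to_trans)
qed simp

lemma annihilates_to_replicate:
  assumes "k \<le> n"
  shows "annihilates_to b (replicate n b \<frown> \<xi>) (replicate k b \<frown> \<xi>)"
proof -
  have "annihilates_to b (replicate (n - k) b \<frown> (replicate k b \<frown> \<xi>)) (replicate k b \<frown> \<xi>)"
    using annihilates_to_filter[of b "replicate (n - k) b" "replicate k b \<frown> \<xi>"] by simp
  with assms show ?thesis
    by (simp flip: replicate_add)
qed

lemma filter_eq_replicate: "filter (\<lambda>c. c \<noteq> False) u = replicate (length (filter id u)) True"
  by (induction u) auto

text \<open>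
  The \<open>j\<close>-th zero of \<open>\<eta>\<close> is matched with the zero of \<open>\<xi>\<close> at \<open>y j\<close>. Between two consecutive
  matched zeroes, all zeroes of \<open>\<xi>\<close> and the surplus ones of \<open>\<eta>\<close> are deleted.
\<close>

lemma annihilates_to_common_prefix:
  fixes z y :: "nat \<Rightarrow> nat"
  assumes "strict_mono z" "strict_mono y" "y 0 \<le> z 0"
    and "\<And>j. y (Suc j) - y j \<le> z (Suc j) - z j"
    and "\<And>i. \<eta> i \<longleftrightarrow> i \<notin> range z" "\<And>j. \<not> \<xi> (y j)"
  shows "\<exists>\<eta>' \<xi>'. annihilates_to True \<eta> \<eta>' \<and> annihilates_to False \<xi> \<xi>' \<and> (\<forall>i<n. \<eta>' i = \<xi>' i)"
  using assms
proof (induction n arbitrary: \<eta> \<xi> z y)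
  case 0
  show ?case by (auto intro: annihilates_to_refl)
next
  case (Suc n)
  note mono = \<open>strict_mono z\<close> \<open>strict_mono y\<close>
  \<comment> \<open>Both sequences are restarted just after their first matched zero, and the
    indices are shifted accordingly. Each stripped pair contributes at least one common digit, its
    zero, which is what the induction on \<open>n\<close> counts.\<close>
  define z' where "z' j = z (Suc j) - Suc (z 0)" for j
  define y' where "y' j = y (Suc j) - Suc (y 0)" for j
  define w where "w = prefix (y 0) \<xi>"
  \<comment> \<open>The number of ones of \<xi> before its first matched zero. Since
    \<open>y 0 \<le> z 0\<close>, the \<open>z 0\<close> leading ones of \<eta> can be cut down to
    exactly \<open>k\<close>.\<close>
  define k where "k = length (filter id w)"
  have less: "z 0 < z (Suc j)" "y 0 < y (Suc j)" for j
    using mono by (auto simp: strict_mono_less)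
  have le: "z 0 \<le> z j" "y 0 \<le> y j" for j
    using mono by (auto simp: strict_mono_less_eq)
  have IH: "\<exists>\<eta>' \<xi>'. annihilates_to True (suffix (Suc (z 0)) \<eta>) \<eta>' \<and>
      annihilates_to False (suffix (Suc (y 0)) \<xi>) \<xi>' \<and> (\<forall>i<n. \<eta>' i = \<xi>' i)"
  proof (rule Suc.IH)
    show "strict_mono z'" "strict_mono y'"
      unfolding z'_def y'_def using mono less
      by (auto simp: strict_mono_def Suc_le_eq intro!: diff_less_mono)
    show "y' 0 \<le> z' 0"
      using Suc.prems(4)[of 0] by (simp add: z'_def y'_def)
    show "y' (Suc j) - y' j \<le> z' (Suc j) - z' j" for j
      using Suc.prems(4)[of "Suc j"] less[of j] less[of "Suc j"] by (simp add: z'_def y'_def)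
    show "suffix (Suc (z 0)) \<eta> i \<longleftrightarrow> i \<notin> range z'" for i
    proof -
      have "Suc (z 0) + i = z j \<longleftrightarrow> (\<exists>m. j = Suc m \<and> i = z' m)" for j
        using less[of "j - 1"] by (cases j) (auto simp: z'_def)
      then show ?thesis
        using Suc.prems(5)[of "Suc (z 0) + i"] by (auto simp: image_iff)
    qed
    show "\<not> suffix (Suc (y 0)) \<xi> (y' j)" for j
      using Suc.prems(6)[of "Suc j"] less[of j] by (simp add: y'_def)
  qed
  then obtain \<eta>' \<xi>' where IH: "annihilates_to True (suffix (Suc (z 0)) \<eta>) \<eta>'"
      "annihilates_to False (suffix (Suc (y 0)) \<xi>) \<xi>'" "\<forall>i<n. \<eta>' i = \<xi>' i"
    by blast
  have "k \<le> z 0"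
    using Suc.prems(3) length_filter_le[of id w] by (simp add: k_def w_def)
  have "\<eta> = replicate (z 0) True \<frown> [False] \<frown> suffix (Suc (z 0)) \<eta>"
  proof
    fix i
    consider "i < z 0" | "i = z 0" | "i > z 0" by linarith
    then show "\<eta> i = (replicate (z 0) True \<frown> [False] \<frown> suffix (Suc (z 0)) \<eta>) i"
      using Suc.prems(5)[of i] le(1)
      by cases (auto simp: conc_def nth_append image_iff dest: leD)
  qed
  moreover have "annihilates_to True (replicate (z 0) True \<frown> [False] \<frown> suffix (Suc (z 0)) \<eta>)
      (replicate k True \<frown> [False] \<frown> suffix (Suc (z 0)) \<eta>)"
    using \<open>k \<le> z 0\<close> by (rule annihilates_to_replicate)
  moreover have "annihilates_to True (replicate k True \<frown> [False] \<frown> suffix (Suc (z 0)) \<eta>)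
      (replicate k True \<frown> [False] \<frown> \<eta>')"
    by (intro annihilates_to_conc IH)
  ultimately have \<eta>: "annihilates_to True \<eta> (replicate k True \<frown> [False] \<frown> \<eta>')"
    by (metis annihilates_to_trans)
  have "\<xi> = w \<frown> [False] \<frown> suffix (Suc (y 0)) \<xi>"
  proof
    fix i
    consider "i < y 0" | "i = y 0" | "i > y 0" by linarith
    then show "\<xi> i = (w \<frown> [False] \<frown> suffix (Suc (y 0)) \<xi>) i"
      using Suc.prems(6)[of 0]
      by cases (auto simp: conc_def nth_append w_def)
  qed
  moreover have "annihilates_to False (w \<frown> [False] \<frown> suffix (Suc (y 0)) \<xi>)
      (replicate k True \<frown> [False] \<frown> suffix (Suc (y 0)) \<xi>)"
    using annihilates_to_filter[of False w] unfolding filter_eq_replicate k_def .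
  moreover have "annihilates_to False (replicate k True \<frown> [False] \<frown> suffix (Suc (y 0)) \<xi>)
      (replicate k True \<frown> [False] \<frown> \<xi>')"
    by (intro annihilates_to_conc IH)
  ultimately have \<xi>: "annihilates_to False \<xi> (replicate k True \<frown> [False] \<frown> \<xi>')"
    by (metis annihilates_to_trans)
  have "\<forall>i<Suc n. (replicate k True \<frown> [False] \<frown> \<eta>') i = (replicate k True \<frown> [False] \<frown> \<xi>') i"
    using IH(3) by (auto simp: conc_def)
  with \<eta> \<xi> show ?case by blast
qed

text \<open>Zeroes picked in blocks \<open>j\<close> and \<open>j + 1\<close> of \<xi> are less than
  \<open>s (j + 2) - s j\<close> apart, and this is exactly the distance between the corresponding
  zeroes of \<eta>, as the difference of \<open>s j + s (Suc j)\<close> telescopes.\<close>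

lemma compatible_if_zero_in_each_block:
  fixes s :: "nat \<Rightarrow> nat"
  assumes "strict_mono s" "s 0 = 0"
    and \<eta>: "\<And>i. \<eta> i \<longleftrightarrow> (\<forall>j. i \<noteq> s j + s (Suc j))"
    and \<xi>: "\<And>j. \<exists>i\<in>{s j..<s (Suc j)}. \<not> \<xi> i"
  shows "compatible \<eta> \<xi>"
proof -
  obtain y where y: "\<And>j. s j \<le> y j" "\<And>j. y j < s (Suc j)" "\<And>j. \<not> \<xi> (y j)"
    using \<xi> by (metis atLeastLessThan_iff)
  show ?thesis
    unfolding compatible_iff_prefixes
  proof (intro allI annihilates_to_common_prefix)
    show "strict_mono (\<lambda>j. s j + s (Suc j))"
      using \<open>strict_mono s\<close> by (simp add: strict_mono_Suc_iff add_strict_mono)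
    show "strict_mono y"
      unfolding strict_mono_Suc_iff using y(1,2) by (meson order_less_le_trans)
    show "y 0 \<le> s 0 + s (Suc 0)"
      using y(2)[of 0] by simp
    show "y (Suc j) - y j \<le> (s (Suc j) + s (Suc (Suc j))) - (s j + s (Suc j))" for j
      using y(1)[of j] y(2)[of "Suc j"] by simp
  qed (use \<eta> y(3) in auto)
qed

section \<open>Sets of dimension one\<close>

lemma finite_shell [simp]: "finite (shell r n)"
  by (simp add: shell_def)

lemma shell_subset: "shell r (Suc n) \<subseteq> {- (r ^ Suc n)..<r ^ Suc n}"
  by (auto simp: shell_def)

lemma real_width_shell:
  assumes "r \<ge> 2"
  shows "real (width (shell r (Suc n))) = 2 * real_of_int r ^ Suc n"
  using arg_cong[OF width_shell[OF assms, of "Suc n"], of real_of_int] by simp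

section \<open>Covers by intervals and the discrete Hausdorff dimension\<close>

lemma width_eq_card:
  assumes "B \<in> intervals"
  shows "width B = card B"
proof -
  obtain x y where "B = {x..<y}" "x \<le> y"
    using assms by (auto simp: intervals_def)
  with width_interval[of x y] show ?thesis by simp
qed

lemma finite_intervals: "B \<in> intervals \<Longrightarrow> finite B"
  by (auto simp: intervals_def)

text \<open>
  For \<open>\<alpha> \<le> 1\<close> and \<open>w \<le> W\<close> one has \<open>w powr \<alpha> \<ge> w * W powr (\<alpha> - 1)\<close>, so a cover by intervals
  no longer than \<open>F\<close> costs at least the number of points it covers, up to scaling.
\<close>

lemma cover_content_ge_card:
  assumes "0 < \<alpha>" "\<alpha> \<le> 1" "finite F" "0 < width F"
  shows "cover_content \<alpha> A F \<ge> ennreal (min 1 (real (card (A \<inter> F)) / real (width F)))"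
proof -
  define W where "W = real (width F)"
  define c where "c = min 1 (real (card (A \<inter> F)) / W)"
  have W: "W > 0" using assms by (simp add: W_def)
  have c: "c \<ge> 0" using W by (simp add: c_def)
  have "ennreal (c * W powr \<alpha>) \<le> (\<Sum>i. ennreal (real (width (B i)) powr \<alpha>))"
    if B: "range B \<subseteq> intervals" "A \<inter> F \<subseteq> (\<Union>i. B i)" for B
  \<comment> \<open>A single interval at least as long as \<open>F\<close> already costs
    \<open>W powr \<alpha>\<close>, and the truncation gives \<open>c \<le> 1\<close>. Otherwise all
    intervals are short and points are counted.\<close>
  proof (cases "\<exists>i. width (B i) \<ge> width F")
    case True
    then obtain i where "width (B i) \<ge> width F" by blast
    then have "c * W powr \<alpha> \<le> 1 * real (width (B i)) powr \<alpha>"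
      using assms by (intro mult_mono powr_mono2) (auto simp: c_def W_def)
    then have "ennreal (c * W powr \<alpha>) \<le> ennreal (real (width (B i)) powr \<alpha>)"
      by (simp add: ennreal_leI)
    also have "\<dots> = (\<Sum>i\<in>{i}. ennreal (real (width (B i)) powr \<alpha>))"
      by simp
    also have "\<dots> \<le> (\<Sum>i. ennreal (real (width (B i)) powr \<alpha>))"
      by (intro sum_le_suminf) auto
    finally show ?thesis .
  next
    case False
    then have short: "real (width (B i)) \<le> W" for i
      by (auto simp: W_def not_le less_imp_le)
    have le: "W powr (\<alpha> - 1) * real (width (B i)) \<le> real (width (B i)) powr \<alpha>" for i
    proof (cases "width (B i) = 0")
      case False
      then have "W powr (\<alpha> - 1) \<le> real (width (B i)) powr (\<alpha> - 1)"
        using short[of i] assms by (intro powr_mono2') auto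
      then have "W powr (\<alpha> - 1) * real (width (B i)) \<le> real (width (B i)) powr (\<alpha> - 1) * real (width (B i)) powr 1"
        using False by (intro mult_mono) auto
      also have "\<dots> = real (width (B i)) powr \<alpha>"
        by (subst powr_add[symmetric]) simp
      finally show ?thesis .
    qed simp
    \<comment> \<open>Counting measure supplies countable subadditivity for the infinite
      cover.\<close>
    have "of_nat (card (A \<inter> F)) = emeasure (count_space UNIV) (A \<inter> F)"
      using assms by (subst emeasure_count_space_finite) auto
    also have "\<dots> \<le> emeasure (count_space UNIV) (\<Union>i. B i)"
      using B by (intro emeasure_mono) auto
    also have "\<dots> \<le> (\<Sum>i. emeasure (count_space UNIV) (B i))"
      by (intro emeasure_subadditive_countably) auto
    also have "\<dots> = (\<Sum>i. ennreal (real (width (B i))))"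
      using B by (intro suminf_cong, subst emeasure_count_space_finite)
        (auto simp: image_subset_iff width_eq_card finite_intervals ennreal_of_nat_eq_real_of_nat)
    finally have card: "ennreal (real (card (A \<inter> F))) \<le> (\<Sum>i. ennreal (real (width (B i))))"
      by (simp add: ennreal_of_nat_eq_real_of_nat)
    have "c * W powr \<alpha> \<le> real (card (A \<inter> F)) / W * W powr \<alpha>"
      by (intro mult_right_mono) (auto simp: c_def)
    also have "\<dots> = W powr (\<alpha> - 1) * real (card (A \<inter> F))"
      using W by (simp add: powr_diff)
    finally have "ennreal (c * W powr \<alpha>) \<le> ennreal (W powr (\<alpha> - 1) * real (card (A \<inter> F)))"
      by (rule ennreal_leI)
    also have "\<dots> = ennreal (W powr (\<alpha> - 1)) * ennreal (real (card (A \<inter> F)))"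
      by (rule ennreal_mult) auto
    also have "\<dots> \<le> ennreal (W powr (\<alpha> - 1)) * (\<Sum>i. ennreal (real (width (B i))))"
      by (intro mult_left_mono card) auto
    also have "\<dots> = (\<Sum>i. ennreal (W powr (\<alpha> - 1) * real (width (B i))))"
      by (simp add: ennreal_suminf_cmult ennreal_mult)
    also have "\<dots> \<le> (\<Sum>i. ennreal (real (width (B i)) powr \<alpha>))"
      by (intro suminf_le ennreal_leI le) auto
    finally show ?thesis .
  qed
  then have "ennreal (c * W powr \<alpha>) * ennreal (W powr (- \<alpha>)) \<le> cover_content \<alpha> A F"
    unfolding cover_content_def W_def by (intro mult_right_mono INF_greatest) auto
  also have "ennreal (c * W powr \<alpha>) * ennreal (W powr (- \<alpha>)) = ennreal c"
    using c W by (simp add: powr_minus field_simps flip: ennreal_mult)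
  finally show ?thesis by (simp add: c_def W_def)
qed

text \<open>Covering by unit intervals costs the full length \<open>W\<close>, whatever \<alpha> is;
  the normalisation then multiplies by \<open>W powr (- \<alpha>)\<close>.\<close>

lemma cover_content_shell_le:
  assumes "r \<ge> 2" "0 < \<alpha>"
  shows "cover_content \<alpha> A (shell r (Suc n)) \<le> ennreal ((2 * real_of_int r ^ Suc n) powr (1 - \<alpha>))"
proof -
  define W where "W = 2 * real_of_int r ^ Suc n"
  define N where "N = nat (2 * r ^ Suc n)"
  have r: "r ^ Suc n > 0" using assms by simp
  have W: "W > 0" using assms by (simp add: W_def)
  have N: "real N = W" using r by (simp add: N_def W_def)
  \<comment> \<open>The first \<open>N\<close> members tile the interval spanned by the shell; the
    remaining ones are empty and add 0 to the sum.\<close>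
  define B where "B i = (if i < N then {- (r ^ Suc n) + int i..<- (r ^ Suc n) + int i + 1} else {0..<0})" for i
  have width: "width (B i) = (if i < N then 1 else 0)" for i
    using width_interval[of "- (r ^ Suc n) + int i" "- (r ^ Suc n) + int i + 1"] width_interval[of 0 0]
    by (auto simp: B_def)
  have "B i \<in> intervals" for i
    by (force simp: B_def intervals_def)
  moreover have "A \<inter> shell r (Suc n) \<subseteq> (\<Union>i. B i)"
  proof
    fix x assume "x \<in> A \<inter> shell r (Suc n)"
    then have x: "- (r ^ Suc n) \<le> x" "x < r ^ Suc n"
      using shell_subset[of r n] by auto
    then have "x \<in> B (nat (x + r ^ Suc n))"
      by (auto simp: B_def N_def)
    then show "x \<in> (\<Union>i. B i)" by blast
  qed
  ultimately have "cover_content \<alpha> A (shell r (Suc n))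
      \<le> (\<Sum>i. ennreal (real (width (B i)) powr \<alpha>)) * ennreal (real (width (shell r (Suc n))) powr (- \<alpha>))"
    unfolding cover_content_def by (intro mult_right_mono INF_lower) auto
  also have "(\<Sum>i. ennreal (real (width (B i)) powr \<alpha>)) = (\<Sum>i<N. ennreal (real (width (B i)) powr \<alpha>))"
    using assms by (intro suminf_finite) (auto simp: width)
  also have "\<dots> = ennreal W"
    by (simp add: width N ennreal_of_nat_eq_real_of_nat)
  also have "ennreal W * ennreal (real (width (shell r (Suc n))) powr (- \<alpha>)) = ennreal (W powr (1 - \<alpha>))"
    using W real_width_shell[OF assms(1), of n] unfolding W_def[symmetric]
    by (simp add: powr_diff powr_minus divide_inverse flip: ennreal_mult)
  finally show ?thesis by (simp add: W_def)
qed

lemma power_powr_commute: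
  fixes x :: real
  assumes "x > 0"
  shows "(x ^ n) powr a = (x powr a) ^ n"
  using assms by (simp add: powr_powr mult.commute flip: powr_realpow)

text \<open>The unit-interval bound on the shells is a geometric series of ratio
  \<open>r powr (1 - \<alpha>)\<close>, which is below 1.\<close>

lemma discrete_hausdorff_measure_finite:
  assumes "r \<ge> 2" "\<alpha> > 1"
  shows "discrete_hausdorff_measure r \<alpha> A < \<infinity>"
proof -
  define q where "q = real_of_int r powr (1 - \<alpha>)"
  have q: "0 \<le> q" "q < 1"
    using assms powr_less_mono[of "1 - \<alpha>" 0 "real_of_int r"] by (auto simp: q_def)
  have "discrete_hausdorff_measure r \<alpha> A \<le> (\<Sum>n. ennreal (2 powr (1 - \<alpha>) * q * q ^ n))"
    unfolding discrete_hausdorff_measure_def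
  proof (intro suminf_le)
    fix n
    have "(2 * real_of_int r ^ Suc n) powr (1 - \<alpha>) = 2 powr (1 - \<alpha>) * q * q ^ n"
      using assms by (simp add: powr_mult power_powr_commute q_def del: power_Suc) simp
    then show "cover_content \<alpha> A (shell r (Suc n)) \<le> ennreal (2 powr (1 - \<alpha>) * q * q ^ n)"
      using cover_content_shell_le[of r \<alpha> A n] assms by simp
  qed auto
  also have "\<dots> = ennreal (\<Sum>n. 2 powr (1 - \<alpha>) * q * q ^ n)"
    using q by (intro suminf_ennreal2 summable_mult summable_geometric) auto
  also have "\<dots> < \<infinity>" by simp
  finally show ?thesis .
qed

text \<open>The proportion of a shell occupied by \<open>A\<close> is at least of order
  \<open>1 / n\<close>, so the series dominates a multiple of the harmonic series.\<close>

lemma discrete_hausdorff_measure_infinite: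
  assumes "r \<ge> 2" "0 < \<alpha>" "\<alpha> \<le> 1" "c > 0"
    and dense: "\<forall>\<^sub>F n in sequentially. c * real_of_int r ^ n / real n \<le> real (card (A \<inter> shell r n))"
  shows "discrete_hausdorff_measure r \<alpha> A = \<infinity>"
proof (rule ccontr)
  assume "\<not> ?thesis"
  define f where "f n = min 1 (real (card (A \<inter> shell r (Suc n))) / real (width (shell r (Suc n))))" for n
  have "ennreal (f n) \<le> cover_content \<alpha> A (shell r (Suc n))" for n
    unfolding f_def using real_width_shell[OF assms(1), of n] assms
    by (intro cover_content_ge_card) (auto intro: ccontr)
  then have "(\<Sum>n. ennreal (f n)) \<le> discrete_hausdorff_measure r \<alpha> A"
    unfolding discrete_hausdorff_measure_def by (intro suminf_le) auto
  with \<open>\<not> ?thesis\<close> have "(\<Sum>n. ennreal (f n)) \<noteq> top"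
    by (auto simp: top_unique)
  then have "summable f"
    by (intro summable_suminf_not_top) (auto simp: f_def)
  \<comment> \<open>The factor \<open>min 1 (c / 2)\<close> serves both branches of
    \<open>f\<close>: 1 for the truncation, and \<open>c / 2\<close> for the density, because the
    width of a shell is twice its radius.\<close>
  moreover have "\<forall>\<^sub>F n in sequentially. norm (min 1 (c / 2) * inverse (real (Suc n))) \<le> f n"
    using eventually_sequentially_Suc[THEN iffD2, OF dense]
  proof eventually_elim
    case (elim n)
    define x where "x = real_of_int r ^ Suc n"
    have "x > 0" using \<open>r \<ge> 2\<close> by (simp add: x_def)
    have le_1: "min 1 (c / 2) * inverse (real (Suc n)) \<le> 1 * 1"
      using \<open>c > 0\<close> by (intro mult_mono) (auto simp: field_simps)
    have "min 1 (c / 2) * inverse (real (Suc n)) \<le> c / 2 * inverse (real (Suc n))"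
      by (intro mult_right_mono) auto
    also have "c / 2 * inverse (real (Suc n)) = (c * x / real (Suc n)) / (2 * x)"
      using \<open>x > 0\<close> by (simp add: field_simps del: of_nat_Suc)
    also have "\<dots> \<le> real (card (A \<inter> shell r (Suc n))) / (2 * x)"
      using elim \<open>x > 0\<close> unfolding x_def[symmetric] by (intro divide_right_mono) auto
    finally show ?case
      using \<open>c > 0\<close> le_1 unfolding f_def real_width_shell[OF assms(1)] x_def[symmetric] by simp
  qed
  ultimately have "summable (\<lambda>n. min 1 (c / 2) * inverse (real (Suc n)))"
    by (rule summable_comparison_test_ev[rotated])
  then have "summable (\<lambda>n. inverse (real (Suc n)))"
    using \<open>c > 0\<close> by (subst (asm) summable_cmult_iff) auto
  then show False
    using not_summable_harmonic[where 'a = real] by (simp add: summable_Suc_iff[of "\<lambda>n. inverse (real n)"] del: of_nat_Suc)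
qed

text \<open>Both dimensions are infima of sets with a threshold at 1; on which side 1 itself falls
  does not affect the infimum.\<close>

lemma Inf_eq_one:
  fixes S :: "real set"
  assumes "\<And>\<alpha>. \<alpha> > 1 \<Longrightarrow> \<alpha> \<in> S" "\<And>\<alpha>. \<alpha> < 1 \<Longrightarrow> \<alpha> \<notin> S"
  shows "Inf S = 1"
proof (rule antisym)
  have bdd: "bdd_below S"
    using assms(2) by (intro bdd_belowI[of _ 1]) (meson not_le)
  show "Inf S \<le> 1"
    by (rule field_le_epsilon) (use bdd assms(1) in \<open>auto intro: cInf_lower\<close>)
  show "1 \<le> Inf S"
    using assms(1)[of 2] assms(2) by (intro cInf_greatest) (auto simp: not_less[symmetric])
qed

lemma hausdorff_dim_eq_one:
  assumes "r \<ge> 2" "c > 0"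
    and "\<forall>\<^sub>F n in sequentially. c * real_of_int r ^ n / real n \<le> real (card (A \<inter> shell r n))"
  shows "hausdorff_dim r A = 1"
  unfolding hausdorff_dim_def
proof (rule Inf_eq_one)
  fix \<alpha> :: real
  show "\<alpha> \<in> {\<alpha>. 0 < \<alpha> \<and> discrete_hausdorff_measure r \<alpha> A < \<infinity>}" if "\<alpha> > 1"
    using discrete_hausdorff_measure_finite[OF assms(1)] that by simp
  show "\<alpha> \<notin> {\<alpha>. 0 < \<alpha> \<and> discrete_hausdorff_measure r \<alpha> A < \<infinity>}" if "\<alpha> < 1"
    using discrete_hausdorff_measure_infinite[of r \<alpha> c A] assms that by (cases "\<alpha> > 0") auto
qed

section \<open>Packing numbers and the upper entropy index\<close>

lemma packing_families:
  fixes A :: "int set"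
  assumes "finite A"
  shows "finite {card \<S> |\<S>. \<S> \<subseteq> {{c - int d..<c + int d} |c. c \<in> A} \<and> disjoint \<S>}"
    and "{card \<S> |\<S>. \<S> \<subseteq> {{c - int d..<c + int d} |c. c \<in> A} \<and> disjoint \<S>} \<noteq> {}"
proof -
  have "finite {{c - int d..<c + int d} |c. c \<in> A}"
    using assms by (simp add: setcompr_eq_image)
  then have "finite (card ` Pow {{c - int d..<c + int d} |c. c \<in> A})"
    by blast
  then show "finite {card \<S> |\<S>. \<S> \<subseteq> {{c - int d..<c + int d} |c. c \<in> A} \<and> disjoint \<S>}"
    by (rule finite_subset[rotated]) auto
  show "{card \<S> |\<S>. \<S> \<subseteq> {{c - int d..<c + int d} |c. c \<in> A} \<and> disjoint \<S>} \<noteq> {}"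
    by (auto intro!: exI[of _ "{}"])
qed

text \<open>Volume argument: disjoint intervals of length \<open>2 * d\<close> with centres in
  \<open>{a..<b}\<close> all lie in that interval enlarged by \<open>d\<close> on both
  sides.\<close>

lemma packing_number_le:
  assumes A: "A \<subseteq> {a..<b}" and "a < b"
  shows "2 * int d * int (packing_number d A) \<le> b - a + 2 * int d"
proof -
  have fin: "finite A" using A finite_subset by blast
  \<comment> \<open>The maximum is attained, since the set of cardinalities is finite and
    nonempty.\<close>
  obtain \<S> where \<S>: "\<S> \<subseteq> {{c - int d..<c + int d} |c. c \<in> A}" "disjoint \<S>" "packing_number d A = card \<S>"
    using Max_in[OF packing_families[OF fin, of d]] unfolding packing_number_def by blast
  have finite: "finite \<S>"
    by (rule finite_subset[OF \<S>(1)]) (simp add: fin setcompr_eq_image)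
  have card: "card X = 2 * d" if "X \<in> \<S>" for X
    using \<S>(1) that by force
  have "2 * d * card \<S> = (\<Sum>X\<in>\<S>. card X)"
    using card by simp
  also have "\<dots> = card (\<Union>\<S>)"
    by (intro card_Union_disjoint[symmetric] \<S>(2)) (use \<S>(1) in auto)
  also have "\<dots> \<le> card {a - int d..<b + int d}"
    by (intro card_mono) (use \<S>(1) A in fastforce)+
  finally have "int (2 * d * card \<S>) \<le> int (card {a - int d..<b + int d})"
    by (simp only: of_nat_le_iff)
  then show ?thesis
    using \<open>a < b\<close> by (simp add: \<S>(3))
qed

text \<open>Intervals of length 2 centred at distinct points of equal parity are disjoint, so the
  even and the odd points of \<open>A\<close> each give a packing.\<close>

lemma packing_number_one_ge:
  assumes "finite A"
  shows "card A \<le> 2 * packing_number 1 A"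
proof -
  have *: "card B \<le> packing_number 1 A" if "B \<subseteq> A" and parity: "\<And>x y. x \<in> B \<Longrightarrow> y \<in> B \<Longrightarrow> even (x - y)" for B
  proof -
    define \<S> where "\<S> = (\<lambda>c. {c - int 1..<c + int 1}) ` B"
    have "inj_on (\<lambda>c. {c - int 1..<c + int 1}) B"
      by (auto simp: inj_on_def atLeastLessThan_eq_iff)
    then have "card \<S> = card B"
      unfolding \<S>_def by (rule card_image)
    moreover have "{x - int 1..<x + int 1} \<inter> {y - int 1..<y + int 1} = {}"
      if xy: "x \<in> B" "y \<in> B" "x \<noteq> y" for x y
    proof -
      obtain k where "x - y = 2 * k"
        using parity[OF xy(1,2)] by (elim evenE)
      with \<open>x \<noteq> y\<close> have "x + 2 \<le> y \<or> y + 2 \<le> x"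
        by presburger
      then show ?thesis by auto
    qed
    then have "disjoint \<S>"
      unfolding \<S>_def disjoint_def by blast
    moreover have "\<S> \<subseteq> {{c - int 1..<c + int 1} |c. c \<in> A}"
      using \<open>B \<subseteq> A\<close> by (auto simp: \<S>_def)
    ultimately show ?thesis
      unfolding packing_number_def by (intro Max_ge packing_families(1) assms) (auto intro!: exI[of _ \<S>])
  qed
  have "card A = card {x \<in> A. even x} + card {x \<in> A. odd x}"
    using assms by (subst card_Un_disjoint[symmetric]) (auto intro: arg_cong[where f = card])
  also have "\<dots> \<le> packing_number 1 A + packing_number 1 A"
    by (intro add_mono *) auto
  finally show ?thesis by simp
qed

text \<open>Above 1, the volume bound and the restriction on \<open>d\<close> force geometric decay.
  Below 1, the single scale \<open>d = 1\<close> already prevents convergence to 0, since the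
  packing number is then at least half the number of points.\<close>

lemma upper_entropy_index_eq_one:
  assumes r: "r \<ge> 2" and "c > 0"
    and dense: "\<forall>\<^sub>F n in sequentially. c * real_of_int r ^ n / real n \<le> real (card (A \<inter> shell r n))"
  shows "upper_entropy_index r A = 1"
  unfolding upper_entropy_index_def
proof (rule Inf_eq_one, unfold mem_Collect_eq)
  define R where "R = real_of_int r"
  have R: "R \<ge> 2" using r by (simp add: R_def)
  fix \<alpha> :: real
  define T where "T \<epsilon> n = (SUP d \<in> {d :: nat. 1 \<le> d \<and> real d \<le> R powr (real n * (1 - \<epsilon>))}.
    ennreal ((real d * R powr (- real n)) powr \<alpha> * real (packing_number d (A \<inter> shell r n))))" for \<epsilon> n
  show "0 < \<alpha> \<and> (\<forall>\<epsilon>'>0. (\<lambda>n. SUP d \<in> {d :: nat. 1 \<le> d \<and> real d \<le> real_of_int r powr (real n * (1 - \<epsilon>'))}.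
    ennreal ((real d * real_of_int r powr (- real n)) powr \<alpha> * real (packing_number d (A \<inter> shell r n)))) \<longlonglongrightarrow> 0)"
    if "\<alpha> > 1"
    unfolding R_def[symmetric] T_def[symmetric]
  proof (intro conjI allI impI)
    fix \<epsilon> :: real assume "\<epsilon> > 0"
    have bound: "T \<epsilon> (Suc n) \<le> ennreal (2 * (R powr (- (\<epsilon> * (\<alpha> - 1)))) ^ Suc n)" for n
      unfolding T_def
    proof (intro SUP_least ennreal_leI, clarify)
      fix d :: nat assume d: "1 \<le> d" "real d \<le> R powr (real (Suc n) * (1 - \<epsilon>))"
      define t where "t = real d * R powr (- real (Suc n))"
      have t: "0 < t" "t \<le> R powr (- (\<epsilon> * real (Suc n)))"
      proof -
        show "0 < t" using d R by (simp add: t_def)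
        have "t \<le> R powr (real (Suc n) * (1 - \<epsilon>)) * R powr (- real (Suc n))"
          unfolding t_def using d by (intro mult_right_mono) auto
        also have "\<dots> = R powr (- (\<epsilon> * real (Suc n)))"
          by (simp add: algebra_simps flip: powr_add)
        finally show "t \<le> R powr (- (\<epsilon> * real (Suc n)))" .
      qed
      have "R powr (- (\<epsilon> * real (Suc n))) \<le> R powr 0"
        using R \<open>\<epsilon> > 0\<close> by (intro powr_mono) auto
      with t R have "t \<le> 1" by simp
      have dt: "real d = t * R ^ Suc n"
        using R by (simp add: t_def powr_minus powr_realpow field_simps del: of_nat_Suc power_Suc)
      have "2 * int d * int (packing_number d (A \<inter> shell r (Suc n))) \<le> r ^ Suc n - - (r ^ Suc n) + 2 * int d"
      proof (rule packing_number_le)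
        show "A \<inter> shell r (Suc n) \<subseteq> {- (r ^ Suc n)..<r ^ Suc n}"
          using shell_subset[of r n] by blast
        have "0 < r ^ Suc n" using r by simp
        then show "- (r ^ Suc n) < r ^ Suc n" by linarith
      qed
      then have "of_int (2 * int d * int (packing_number d (A \<inter> shell r (Suc n)))) \<le> (of_int (r ^ Suc n - - (r ^ Suc n) + 2 * int d) :: real)"
        by (simp only: of_int_le_iff)
      then have "real d * real (packing_number d (A \<inter> shell r (Suc n))) \<le> R ^ Suc n + real d"
        by (simp add: R_def)
      also have "\<dots> \<le> 2 * R ^ Suc n"
        using \<open>t \<le> 1\<close> R t(1) by (simp add: dt del: power_Suc)
      finally have "R ^ Suc n * (t * real (packing_number d (A \<inter> shell r (Suc n)))) \<le> R ^ Suc n * 2"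
        by (simp add: dt mult_ac del: power_Suc)
      then have tN: "t * real (packing_number d (A \<inter> shell r (Suc n))) \<le> 2"
        using R by (subst (asm) mult_le_cancel_left_pos) auto
      \<comment> \<open>One factor \<open>t\<close> is spent on the volume bound \<open>tN\<close>;
        the remaining power \<open>\<alpha> - 1\<close> of \<open>t\<close> gives the decay.\<close>
      have "t powr \<alpha> * real (packing_number d (A \<inter> shell r (Suc n)))
          = t powr (\<alpha> - 1) * (t * real (packing_number d (A \<inter> shell r (Suc n))))"
        using t(1) by (simp add: powr_diff)
      also have "\<dots> \<le> (R powr (- (\<epsilon> * real (Suc n)))) powr (\<alpha> - 1) * 2"
        using t \<open>\<alpha> > 1\<close> by (intro mult_mono tN powr_mono2) auto
      also have "\<dots> = 2 * (R powr (- (\<epsilon> * (\<alpha> - 1)))) ^ Suc n"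
        using R by (simp add: power_powr_commute powr_powr algebra_simps del: of_nat_Suc power_Suc flip: powr_realpow)
      finally show "(real d * R powr (- real (Suc n))) powr \<alpha> * real (packing_number d (A \<inter> shell r (Suc n)))
          \<le> 2 * (R powr (- (\<epsilon> * (\<alpha> - 1)))) ^ Suc n"
        by (simp only: t_def)
    qed
    have "R powr (- (\<epsilon> * (\<alpha> - 1))) < R powr 0"
      using R \<open>\<epsilon> > 0\<close> \<open>\<alpha> > 1\<close> by (intro powr_less_mono) auto
    then have "(\<lambda>n. 2 * (R powr (- (\<epsilon> * (\<alpha> - 1)))) ^ Suc n) \<longlonglongrightarrow> 2 * 0"
      using R by (intro tendsto_mult_left LIMSEQ_Suc LIMSEQ_power_zero) auto
    then have "(\<lambda>n. ennreal (2 * (R powr (- (\<epsilon> * (\<alpha> - 1)))) ^ Suc n)) \<longlonglongrightarrow> 0"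
      using tendsto_ennrealI by (simp flip: ennreal_0)
    then have "(\<lambda>n. T \<epsilon> (Suc n)) \<longlonglongrightarrow> 0"
      by (rule tendsto_sandwich[OF _ _ tendsto_const, rotated 2]) (use bound in auto)
    then show "T \<epsilon> \<longlonglongrightarrow> 0"
      by (rule LIMSEQ_imp_Suc)
  qed (use that in simp)
  show "\<not> (0 < \<alpha> \<and> (\<forall>\<epsilon>'>0. (\<lambda>n. SUP d \<in> {d :: nat. 1 \<le> d \<and> real d \<le> real_of_int r powr (real n * (1 - \<epsilon>'))}.
    ennreal ((real d * real_of_int r powr (- real n)) powr \<alpha> * real (packing_number d (A \<inter> shell r n)))) \<longlonglongrightarrow> 0))"
    if "\<alpha> < 1"
    unfolding R_def[symmetric] T_def[symmetric]
  proof
    assume "0 < \<alpha> \<and> (\<forall>\<epsilon>'>0. T \<epsilon>' \<longlonglongrightarrow> 0)"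
    \<comment> \<open>The value 1/2 keeps \<open>d = 1\<close> admissible for every
      \<open>n\<close>.\<close>
    then have "T (1/2) \<longlonglongrightarrow> 0" by simp
    then have small: "\<forall>\<^sub>F n in sequentially. T (1/2) n < 1"
      by (rule order_tendstoD) simp
    have big: "\<forall>\<^sub>F n in sequentially. R powr (- (real n * \<alpha>)) * (c * R ^ n / real n / 2) \<ge> 1"
    proof -
      have "1 - \<alpha> > 0" "R > 1" using that R by auto
      then have "filterlim (\<lambda>n. c / 2 * (R powr ((1 - \<alpha>) * real n) / real n)) at_top sequentially"
        using \<open>c > 0\<close> by real_asymp
      moreover have "c / 2 * (R powr ((1 - \<alpha>) * real n) / real n) = R powr (- (real n * \<alpha>)) * (c * R ^ n / real n / 2)" for n
      proof -
        have "R powr ((1 - \<alpha>) * real n) = R powr (- (real n * \<alpha>)) * R powr real n"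
          by (simp add: algebra_simps flip: powr_add)
        then show ?thesis using R by (simp add: powr_realpow mult_ac)
      qed
      ultimately show ?thesis
        by (simp add: filterlim_at_top)
    qed
    have "\<forall>\<^sub>F n in sequentially. False"
      using small big dense
    proof eventually_elim
      case (elim n)
      have "1 \<le> R powr (- (real n * \<alpha>)) * (c * R ^ n / real n / 2)"
        by (fact elim(2))
      also have "c * R ^ n / real n / 2 \<le> real (packing_number 1 (A \<inter> shell r n))"
        using elim(3) packing_number_one_ge[of "A \<inter> shell r n"] by (simp add: R_def)
      also have "R powr (- (real n * \<alpha>)) = (real 1 * R powr (- real n)) powr \<alpha>"
        by (simp add: powr_powr)
      finally have "1 \<le> ennreal ((real 1 * R powr (- real n)) powr \<alpha> * real (packing_number 1 (A \<inter> shell r n)))"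
        by (simp add: mult_left_mono)
      also have "\<dots> \<le> T (1/2) n"
        unfolding T_def using R by (intro SUP_upper) (auto intro: ge_one_powr_ge_zero)
      finally show ?case using elim(1) by simp
    qed
    then show False by simp
  qed
qed

section \<open>A sequence with logarithmic gaps between its zeroes\<close>

text \<open>The least \<open>k\<close> with \<open>j + 2 \<le> 2 ^ k\<close>. The shift by 2 makes
  even block 0 nonempty.\<close>

definition block_length :: "nat \<Rightarrow> nat" where
  "block_length j = ceillog2 (j + 2)"

definition block_start :: "nat \<Rightarrow> nat" where
  "block_start j = (\<Sum>i<j. block_length i)"

text \<open>Consecutive values differ by the total length of two neighbouring blocks, the form
  required by \<open>compatible_if_zero_in_each_block\<close>.\<close>

definition zero_position :: "nat \<Rightarrow> nat" where
  "zero_position j = block_start j + block_start (Suc j)"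

definition sparse_zeros :: binseq where
  "sparse_zeros i \<longleftrightarrow> (\<forall>j. i \<noteq> zero_position j)"

lemma block_length_pos: "block_length j > 0"
  using ceillog2_le_iff[of "j + 2" 0] by (simp add: block_length_def)

lemma two_power_block_length: "j + 2 \<le> 2 ^ block_length j"
  unfolding block_length_def by (rule le_two_power_ceillog2)

lemma block_length_le: "j + 2 \<le> 2 ^ k \<Longrightarrow> block_length j \<le> k"
  by (simp add: block_length_def ceillog2_le_iff)

lemma block_start_Suc: "block_start (Suc j) = block_start j + block_length j"
  by (simp add: block_start_def)

lemma strict_mono_block_start: "strict_mono block_start"
  by (simp add: strict_mono_Suc_iff block_start_Suc block_length_pos)

lemma zero_position_Suc: "zero_position (Suc j) = zero_position j + (block_length j + block_length (Suc j))"
  by (simp add: zero_position_def block_start_Suc)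

lemma strict_mono_zero_position: "strict_mono zero_position"
  by (simp add: strict_mono_Suc_iff zero_position_Suc block_length_pos)

section \<open>Positive probability that every block contains a zero\<close>

lemma power_block_length_le:
  fixes p :: real
  assumes "0 \<le> p" "p \<le> 1 / 8"
  shows "p ^ block_length j \<le> 1 / 2 * (inverse (real (j + 1)) - inverse (real (Suc j + 1)))"
proof -
  define m where "m = real (j + 2)"
  have m: "2 \<le> m" "m \<le> 2 ^ block_length j"
    using two_power_block_length[of j] unfolding m_def by (simp, metis of_nat_le_iff of_nat_numeral of_nat_power)
  \<comment> \<open>As 1/8 is the cube of 1/2, the power is at most \<open>1 / m ^ 3\<close>, which
    is summable.\<close>
  have "p ^ block_length j \<le> (1 / 8) ^ block_length j"
    using assms by (intro power_mono) auto
  also have "\<dots> = 1 / (2 ^ block_length j) ^ 3"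
    using power_mult[of "2::real" 3 "block_length j"] power_mult[of "2::real" "block_length j" 3]
    by (simp add: power_divide mult.commute)
  also have "\<dots> \<le> 1 / m ^ 3"
    using m by (intro divide_left_mono power_mono mult_pos_pos zero_less_power) auto
  \<comment> \<open>One factor \<open>m \<ge> 2\<close> is traded for the 2, leaving half of the
    telescoping term \<open>1 / (m * (m - 1))\<close>.\<close>
  also have "\<dots> \<le> 1 / (2 * (m * (m - 1)))"
  proof (intro divide_left_mono)
    have "2 * (m * (m - 1)) \<le> m * (m * m)"
      using m by (intro mult_mono[of 2 m "m * (m - 1)" "m * m"] mult_left_mono) auto
    then show "2 * (m * (m - 1)) \<le> m ^ 3" by (simp add: power3_eq_cube)
    show "0 < m ^ 3 * (2 * (m * (m - 1)))" using m by simp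
  qed auto
  also have "\<dots> = 1 / 2 * (inverse (m - 1) - inverse m)"
    using m by (simp add: field_simps)
  finally show ?thesis by (simp add: m_def algebra_simps)
qed

text \<open>Union bound: the telescoping bounds add up to 1/2, so with probability at least 1/2
  every block of \<xi> contains a zero and the matching applies.\<close>

lemma prob_compatible_pos:
  assumes "p \<in> {0..1}" "p \<le> 1 / 8"
  shows "measure (bernoulli_product p) {\<xi>. compatible sparse_zeros \<xi>} > 0"
proof -
  interpret prob_space "bernoulli_product p"
    by (rule prob_space_bernoulli_product)
  define bad where "bad j = {\<xi>. \<forall>i\<in>{block_start j..<block_start (Suc j)}. \<xi> i}" for j
  define a where "a j = 1 / 2 * (inverse (real (j + 1)) - inverse (real (Suc j + 1)))" for j
  have bad: "prob (bad j) = p ^ block_length j" "bad j \<in> events" for j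
    using prob_all_ones[of "{block_start j..<block_start (Suc j)}" p] assms
    by (simp_all add: bad_def block_start_Suc)
  have le: "prob (bad j) \<le> a j" for j
    unfolding bad(1) a_def using assms by (intro power_block_length_le) auto
  have "a sums (1 / 2 * (inverse (real (0 + 1)) - 0))"
    unfolding a_def by (intro sums_mult telescope_sums') real_asymp
  then have a: "summable a" "suminf a = 1 / 2"
    by (auto simp: sums_iff)
  have summable: "summable (\<lambda>j. prob (bad j))"
    by (rule summable_comparison_test'[OF a(1)]) (use le in auto)
  have "prob (\<Union>j. bad j) \<le> (\<Sum>j. prob (bad j))"
    using bad(2) summable by (intro finite_measure_subadditive_countably) auto
  also have "\<dots> \<le> 1 / 2"
    unfolding a(2)[symmetric] by (intro suminf_le le summable a)
  finally have "prob (\<Union>j. bad j) < 1" by simp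
  then have "0 < prob (space (bernoulli_product p) - (\<Union>j. bad j))"
    using bad(2) by (subst prob_compl) auto
  also have "\<dots> \<le> prob {\<xi>. compatible sparse_zeros \<xi>}"
  proof (intro finite_measure_mono measurable_compatible subsetI, unfold mem_Collect_eq)
    fix \<xi> assume "\<xi> \<in> space (bernoulli_product p) - (\<Union>j. bad j)"
    then show "compatible sparse_zeros \<xi>"
      by (intro compatible_if_zero_in_each_block[OF strict_mono_block_start])
         (auto simp: block_start_def sparse_zeros_def zero_position_def bad_def)
  qed
  finally show ?thesis .
qed

section \<open>Counting the zeroes in a shell\<close>

lemma zeroes_sparse_zeros: "zeroes sparse_zeros = range (\<lambda>j. int (Suc (zero_position j)))"
  by (auto simp: zeroes_def sparse_zeros_def)

text \<open>Intervals of length \<open>G\<close> starting at the values of \<open>z\<close> in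
  \<open>{a..<b}\<close> cover \<open>{a + G..<b}\<close>. The margin \<open>G\<close> at the left
  end accounts for the \<open>+ 1\<close>.\<close>

lemma card_strict_mono_range_ge:
  fixes z :: "nat \<Rightarrow> nat"
  assumes "strict_mono z" "z 0 < a + G" and gap: "\<And>j. z j < b \<Longrightarrow> z (Suc j) \<le> z j + G"
  shows "b \<le> a + G * (card (range z \<inter> {a..<b}) + 1)"
proof -
  have "{a + G..<b} \<subseteq> (\<Union>x\<in>range z \<inter> {a..<b}. {x..<x + G})"
  proof
    fix i assume i: "i \<in> {a + G..<b}"
    define J where "J = {j. z j \<le> i}"
    have "J \<subseteq> {..i}"
      using strict_mono_imp_increasing[OF \<open>strict_mono z\<close>] by (auto simp: J_def intro: order_trans)
    then have fin: "finite J" by (rule finite_subset) simp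
    have "0 \<in> J" using assms(2) i by (auto simp: J_def)
    \<comment> \<open>The last index with value at most \<open>i\<close>; as the gap is at most
      \<open>G\<close> and \<open>i \<ge> a + G\<close>, its value is at least
      \<open>a\<close>.\<close>
    define j where "j = Max J"
    have "j \<in> J" "Suc j \<notin> J"
      using Max_in[OF fin] Max_ge[OF fin, of "Suc j"] \<open>0 \<in> J\<close> by (auto simp: j_def)
    then have "z j \<le> i" "i < z (Suc j)" by (auto simp: J_def)
    moreover from this have "z (Suc j) \<le> z j + G"
      using i by (intro gap) auto
    ultimately have "z j \<in> range z \<inter> {a..<b}" "i \<in> {z j..<z j + G}"
      using i by auto
    then show "i \<in> (\<Union>x\<in>range z \<inter> {a..<b}. {x..<x + G})" by blast
  qed
  then have "card {a + G..<b} \<le> card (\<Union>x\<in>range z \<inter> {a..<b}. {x..<x + G})"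
    by (intro card_mono) auto
  also have "\<dots> \<le> (\<Sum>x\<in>range z \<inter> {a..<b}. card {x..<x + G})"
    by (intro card_UN_le) auto
  finally show ?thesis by (simp add: algebra_simps)
qed

text \<open>A zero below \<open>r ^ n\<close> has index below \<open>r ^ n\<close>, so its two
  adjacent blocks have length at most about \<open>r * n\<close>, which bounds the gap to the next
  zero.\<close>

lemma card_zeroes_shell_ge:
  assumes r: "r \<ge> 2" and n: "n \<ge> 2"
  shows "r ^ n \<le> r ^ (n - 1) + 2 * (r * int n + 2) * (int (card (zeroes sparse_zeros \<inter> shell r n)) + 1)"
proof -
  define q where "q = nat r"
  have q: "q \<ge> 2" "r = int q" using r by (auto simp: q_def)
  define G where "G = 2 * (q * n + 2)"
  have "zero_position (Suc j) \<le> zero_position j + G" if "zero_position j < q ^ n - 1" for j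
  proof -
    have "j \<le> zero_position j"
      by (rule strict_mono_imp_increasing[OF strict_mono_zero_position])
    then have "j + 1 \<le> q ^ n" using that by linarith
    \<comment> \<open>The crude bound \<open>q < 2 ^ q\<close> avoids logarithms of
      \<open>r\<close>; only linear growth of the gaps in \<open>n\<close> matters.\<close>
    also have "\<dots> \<le> (2 ^ q) ^ n"
      using less_exp[of q] by (intro power_mono) auto
    finally have "j + 1 \<le> 2 ^ (q * n)" by (simp add: power_mult)
    moreover have "(2::nat) \<le> 2 ^ (q * n + 1)" "(1::nat) \<le> 2 ^ (q * n)" by auto
    ultimately have "block_length j \<le> q * n + 2" "block_length (Suc j) \<le> q * n + 2"
      by (auto intro!: block_length_le simp: power_add)
    then show ?thesis by (simp add: zero_position_Suc G_def)
  qed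
  moreover have "zero_position 0 < q ^ (n - 1) - 1 + G"
    using block_length_le[of 0 1] by (simp add: zero_position_def block_start_def G_def)
  ultimately have "q ^ n - 1 \<le> q ^ (n - 1) - 1 + G * (card (range zero_position \<inter> {q ^ (n - 1) - 1..<q ^ n - 1}) + 1)"
    by (intro card_strict_mono_range_ge strict_mono_zero_position)
  \<comment> \<open>Index \<open>i\<close> is digit position \<open>Suc i\<close>, hence the ends
    lowered by one; the window is the positive half of the shell.\<close>
  moreover have "card (range zero_position \<inter> {q ^ (n - 1) - 1..<q ^ n - 1}) \<le> card (zeroes sparse_zeros \<inter> shell r n)"
  proof (intro card_inj_on_le[of "\<lambda>i. int (Suc i)"] subsetI)
    fix x assume "x \<in> (\<lambda>i. int (Suc i)) ` (range zero_position \<inter> {q ^ (n - 1) - 1..<q ^ n - 1})"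
    then obtain j where j: "x = int (Suc (zero_position j))"
        "q ^ (n - 1) \<le> Suc (zero_position j)" "Suc (zero_position j) < q ^ n"
      by auto
    then have "r ^ (n - 1) \<le> x" "x < r ^ n"
      unfolding j(1) q(2) by (metis of_nat_le_iff of_nat_power, metis of_nat_less_iff of_nat_power)
    then show "x \<in> zeroes sparse_zeros \<inter> shell r n"
      using n j(1) by (auto simp: zeroes_sparse_zeros shell_def)
  qed (auto simp: inj_on_def)
  ultimately have "q ^ n - 1 \<le> q ^ (n - 1) - 1 + G * (card (zeroes sparse_zeros \<inter> shell r n) + 1)"
    by (meson add_left_mono add_right_mono mult_le_mono2 order_trans)
  moreover have "0 < q ^ (n - 1)" using q by simp
  ultimately have "q ^ n \<le> q ^ (n - 1) + G * (card (zeroes sparse_zeros \<inter> shell r n) + 1)"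
    by linarith
  then have "int (q ^ n) \<le> int (q ^ (n - 1) + G * (card (zeroes sparse_zeros \<inter> shell r n) + 1))"
    by (simp only: of_nat_le_iff)
  then show ?thesis by (simp add: q(2) G_def algebra_simps)
qed

text \<open>Since \<open>r ^ (n - 1)\<close> is at most half of \<open>r ^ n\<close> and the gap
  bound is at most \<open>4 * r * n\<close>, the count plus 1 is at least
  \<open>r ^ n / (8 * r * n)\<close>. Replacing 8 by 16 absorbs the 1 for large
  \<open>n\<close>.\<close>

lemma eventually_card_zeroes_shell_ge:
  assumes r: "r \<ge> 2"
  shows "\<forall>\<^sub>F n in sequentially. 1 / (16 * real_of_int r) * real_of_int r ^ n / real n
           \<le> real (card (zeroes sparse_zeros \<inter> shell r n))"
proof -
  define R where "R = real_of_int r"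
  have R: "R \<ge> 2" using r by (simp add: R_def)
  have "R > 1" using R by simp
  then have "filterlim (\<lambda>n. R ^ n / real n) at_top sequentially"
    by real_asymp
  then have "\<forall>\<^sub>F n in sequentially. R ^ n / real n \<ge> 16 * R"
    by (simp add: filterlim_at_top)
  then show ?thesis
    using eventually_ge_at_top[of 2] unfolding R_def[symmetric]
  proof eventually_elim
    case (elim n)
    define N where "N = real (card (zeroes sparse_zeros \<inter> shell r n))"
    have "R ^ n = R * R ^ (n - 1)" using elim by (cases n) auto
    moreover have "2 * R ^ (n - 1) \<le> R * R ^ (n - 1)" using R by (intro mult_right_mono) auto
    ultimately have half: "R ^ (n - 1) \<le> R ^ n / 2" by simp
    have Rn: "2 * 2 \<le> R * real n" using R elim by (intro mult_mono) auto
    have "R ^ n \<le> R ^ (n - 1) + 2 * (R * real n + 2) * (N + 1)"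
    proof -
      have "real_of_int (r ^ n) \<le> real_of_int (r ^ (n - 1) + 2 * (r * int n + 2) *
          (int (card (zeroes sparse_zeros \<inter> shell r n)) + 1))"
        unfolding of_int_le_iff using r \<open>2 \<le> n\<close> by (rule card_zeroes_shell_ge)
      then show ?thesis by (simp add: R_def N_def)
    qed
    also have "2 * (R * real n + 2) * (N + 1) \<le> (4 * (R * real n)) * (N + 1)"
      using Rn by (intro mult_right_mono) (auto simp: N_def)
    finally have "R ^ n / 2 \<le> 4 * (R * real n) * (N + 1)" using half by simp
    then have "R ^ n / real n / (8 * R) \<le> N + 1"
      using R elim by (simp add: field_simps)
    moreover have "R ^ n / real n / (16 * R) \<ge> 1"
      using R divide_right_mono[OF elim(1), of "16 * R"] by simp
    ultimately show "1 / (16 * R) * R ^ n / real n \<le> N"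
      using R by (simp add: field_simps)
  qed
qed

theorem theorem3:
  fixes r :: int and \<epsilon> :: real
  assumes "r \<ge> 2" and "\<epsilon> > 0"
  shows "\<exists>(p\<^sub>\<epsilon> :: real) (\<eta> :: binseq).
           0 < p\<^sub>\<epsilon> \<and> p\<^sub>\<epsilon> < 1 \<and>
           discrete_fractal r (zeroes \<eta>) \<and>
           hausdorff_dim r (zeroes \<eta>) \<ge> 1 - \<epsilon> \<and>
           (\<forall>p\<in>{0..1}. p < p\<^sub>\<epsilon> \<longrightarrow>
              measure (bernoulli_product p) {\<xi>. compatible \<eta> \<xi>} > 0)"
proof (intro exI conjI ballI impI)
  \<comment> \<open>The same sequence and the threshold 1/8 serve every \<epsilon>, because both
    dimensions equal 1 exactly.\<close>
  have c: "1 / (16 * real_of_int r) > 0" using assms by simp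
  note dense = eventually_card_zeroes_shell_ge[OF assms(1)]
  show "discrete_fractal r (zeroes sparse_zeros)"
    unfolding discrete_fractal_def hausdorff_dim_eq_one[OF assms(1) c dense]
      upper_entropy_index_eq_one[OF assms(1) c dense] ..
  show "1 - \<epsilon> \<le> hausdorff_dim r (zeroes sparse_zeros)"
    unfolding hausdorff_dim_eq_one[OF assms(1) c dense] using assms by simp
  show "0 < measure (bernoulli_product p) {\<xi>. compatible sparse_zeros \<xi>}"
    if "p \<in> {0..1}" "p < 1 / 8" for p
    using that by (intro prob_compatible_pos) auto
qed auto

end
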